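(* Let $K>3$, let $\epsilon_1,\dots,\epsilon_K>0$ be pairwise distinct noise strengths, and put $\epsilon=\max_i\epsilon_i$. Let $\mathcal A\in\mathbb R^{K\times 3}$ be the matrix whose $i$-th row is $(-1/\epsilon_i,\,1,\,\epsilon_i)$, let $\hat{\mathbf u}\in\mathbb R^K$ be the random data vector described in the context, satisfying $\hat{\mathbf u}=\mathcal A\bm\beta_0+\mathbf s_0+\mathbf s_1$, and let $$D=\mathrm{diag}\Big\{\sqrt{(1-N_{0,1}/N)^{-1}N_{0,1}},\ \dots,\ \sqrt{(1-N_{0,K}/N)^{-1}N_{0,K}}\Big\}.$$ Let $\bm\beta^*=\arg\min_{\bm\beta\in\mathbb R^3}\|D\mathcal A\bm\beta-D\hat{\mathbf u}\|^2$ and let $\mathbf r=D\mathcal A\bm\beta^*-D\hat{\mathbf u}$ be the rescaled residual. Then $$\mathbf r=\mathbf r_0+\mathbf r_1,$$ where $\|\mathbf r_0\|^2\sim\chi^2(K-3)$ (the chi-squared distribution with $K-3$ degrees of freedom), and $$\|\mathbf r_1\|\le\|(I-P_A)D\|\,O(\epsilon^2),\qquad P_A=D\mathcal A(\mathcal A^TD^2\mathcal A)^{-1}\mathcal A^TD,$$ that is, $\|\mathbf r_1\|\le C\epsilon^2\|(I-P_A)D\|$ with a constant $C$ depending only on the constant in the bound $\|\mathbf s_1\|=O(\epsilon^2)$.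
   Context: $\|\cdot\|$ is the Euclidean norm on vectors and the induced operator norm on matrices; $I$ is the $K\times K$ identity. Origin of the data: $u_\epsilon$ is a probability density on $\mathbb R^n$ of the form $u_\epsilon(\bm x)=Q(\epsilon)^{-1}\big(Z_0(\bm x)+\epsilon Z_1(\bm x)+O(\epsilon^2)\big)\exp(-V(\bm x)/\epsilon)$ with $Q(\epsilon)=(1+C_1\epsilon+O(\epsilon^2))\epsilon^{(n-d)/2}$, where $d$ is the dimension of the zero set of $V$. Fix a point $\bm x^*\in\mathbb R^n$. For each $i$, $u_{\epsilon_i}(\bm x^* )$ is estimated from $N$ samples by $\hat u_{\epsilon_i}(\bm x^* )=N_{0,i}/(hN)$, where $N_{0,i}$ is the number of samples falling in a box of volume $h$ centered at $\bm x^*$, with $0<N_{0,i}<N$. The data vector is $$\hat{\mathbf u}=\big(\log\hat u_{\epsilon_i}(\bm x^* )+\tfrac{n-d}{2}\log\epsilon_i\big)_{i=1}^K,$$ and $\bm\beta_0=\big(V(\bm x^* ),\ \log Z_0(\bm x^* ),\ Z_1(\bm x^* )/Z_0(\bm x^* )-C_1\big)^T\in\mathbb R^3$ is the vector of true values. Statistical model (standing assumptions): $\hat{\mathbf u}=\mathcal A\bm\beta_0+\mathbf s_0+\mathbf s_1$, where - $\mathbf s_0$ is the sampling error, with entries $\mathbf s_{0,i}=\sqrt{(1-N_{0,i}/N)N_{0,i}^{-1}}\;\zeta_i$, where $\zeta_1,\dots,\zeta_K$ are independent standard normal random variables. In this model the numbers $N_{0,i}$ appearing in $\mathbf s_0$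 and in $D$ are treated as fixed constants with $0<N_{0,i}<N$; - $\mathbf s_1\in\mathbb R^K$ is the higher-order remainder, satisfying $\|\mathbf s_1\|=O(\epsilon^2)$, i.e. $\|\mathbf s_1\|\le C\epsilon^2$ for some constant $C$. *)

theory Defs
  imports "HOL-Probability.Probability"
begin

definition diag_matrix :: "('k::finite \<Rightarrow> real) \<Rightarrow> real ^ 'k ^ 'k" where
  "diag_matrix v = (\<chi> i j. if i = j then v i else 0)"

definition design_matrix :: "('k::finite \<Rightarrow> real) \<Rightarrow> real ^ 3 ^ 'k" where
  "design_matrix eps = (\<chi> i. vector [- 1 / eps i, 1, eps i])"

definition weight_matrix :: "nat \<Rightarrow> ('k::finite \<Rightarrow> nat) \<Rightarrow> real ^ 'k ^ 'k" where
  "weight_matrix N N0 = diag_matrix (\<lambda>i. sqrt (inverse (1 - real (N0 i) / real N) * real (N0 i)))"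

definition sampling_error :: "nat \<Rightarrow> ('k::finite \<Rightarrow> nat) \<Rightarrow> ('k \<Rightarrow> 'w \<Rightarrow> real) \<Rightarrow> 'w \<Rightarrow> real ^ 'k" where
  "sampling_error N N0 \<zeta> \<omega> = (\<chi> i. sqrt ((1 - real (N0 i) / real N) * inverse (real (N0 i))) * \<zeta> i \<omega>)"

definition true_values ::
    "('x \<Rightarrow> real) \<Rightarrow> ('x \<Rightarrow> real) \<Rightarrow> ('x \<Rightarrow> real) \<Rightarrow> real \<Rightarrow> 'x \<Rightarrow> real ^ 3" where
  "true_values V Z0 Z1 C1 x = vector [V x, ln (Z0 x), Z1 x / Z0 x - C1]"

definition weighted_lsq :: "real ^ 'k ^ 'k \<Rightarrow> real ^ 'm ^ 'k \<Rightarrow> real ^ 'k \<Rightarrow> real ^ 'm" where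
  "weighted_lsq D A u = (ARG_MIN (\<lambda>\<beta>. (norm ((D ** A) *v \<beta> - D *v u))\<^sup>2) \<beta>. True)"

definition rescaled_residual :: "real ^ 'k ^ 'k \<Rightarrow> real ^ 'm ^ 'k \<Rightarrow> real ^ 'k \<Rightarrow> real ^ 'k" where
  "rescaled_residual D A u = (D ** A) *v weighted_lsq D A u - D *v u"

definition lsq_projection :: "real ^ 'k ^ 'k \<Rightarrow> real ^ 'm ^ 'k \<Rightarrow> real ^ 'k ^ 'k" where
  "lsq_projection D A =
     D ** A ** matrix_inv (transpose A ** (D ** D) ** A) ** transpose A ** D"

text \<open>The chi-squared distribution with \<open>k\<close> degrees of freedom is the law of the sum of the
  squares of \<open>k\<close> independent standard normal random variables.\<close>

definition chi_squared :: "nat \<Rightarrow> real measure" where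
  "chi_squared k =
     distr (Pi\<^sub>M {..<k} (\<lambda>_. density lborel (\<lambda>x. ennreal (std_normal_density x)))) borel
       (\<lambda>x. \<Sum>i<k. (x i)\<^sup>2)"

end

theory Submission
  imports Defs
begin

text \<open>Write \<open>P\<close> for the orthogonal projection onto the range of \<open>D ** A\<close>. The least squares
  fit is \<open>P *v (D *v u)\<close>, so the residual is \<open>- (I - P) *v (D *v u)\<close>. The true values
  contribute nothing because \<open>I - P\<close> annihilates the range of \<open>D ** A\<close>; the sampling error
  contributes \<open>- (I - P) *v \<zeta>\<close> because \<open>D\<close> normalises its entries; and the remainder \<open>s1\<close>
  contributes a term bounded by the operator norm of \<open>(I - P) ** D\<close>. By rotation invariance of
  the standard Gaussian law, the squared norm of its projection onto a subspace of dimension \<open>d\<close>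
  is distributed as a sum of \<open>d\<close> squared coordinates. Here \<open>d = K - 3\<close>, as \<open>A\<close> has full rank:
  a kernel vector gives a quadratic polynomial that vanishes at all \<open>\<epsilon>\<^sub>i\<close>.\<close>

section \<open>Rotation invariance of the standard Gaussian measure\<close>

text \<open>The change-of-variables theory gives this only for index types that are well-ordered. Here
  instead: Vitali's theorem fills the open set with disjoint balls up to a null set, and an
  orthogonal map sends balls to balls of the same radius.\<close>

lemma emeasure_lborel_orthogonal_image_open:
  fixes f :: "'a::euclidean_space \<Rightarrow> 'a"
  assumes f: "orthogonal_transformation f" and U: "open U"
  shows "emeasure lborel (f ` U) = emeasure lborel U"
proof -
  \<comment> \<open>All balls inside \<open>U\<close>, coded as pairs of centre and radius. Each
    point of \<open>U\<close> lies in arbitrarily small ones, which is the fineness that Vitali's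
    theorem asks for.\<close>
  define K where "K = {(x, r). 0 < r \<and> ball x r \<subseteq> U}"
  have "\<exists>i. i \<in> K \<and> x \<in> ball (fst i) (snd i) \<and> snd i < d" if x: "x \<in> U" and d: "0 < d" for x d
  proof -
    obtain e where e: "e > 0" "ball x e \<subseteq> U"
      using U x open_contains_ball by blast
    then have "(x, min e (d / 2)) \<in> K"
      using d by (auto simp: K_def)
    then show ?thesis
      using e d by (intro exI[of _ "(x, min e (d / 2))"]) auto
  qed
  then obtain C where C: "countable C" "C \<subseteq> K"
      and disj: "pairwise (\<lambda>i j. disjnt (ball (fst i) (snd i)) (ball (fst j) (snd j))) C"
      and neg: "negligible (U - (\<Union>i\<in>C. ball (fst i) (snd i)))"
    using Vitali_covering_theorem_balls[of U K fst snd] by blast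
  define W where "W = (\<Union>i\<in>C. ball (fst i) (snd i))"
  have r: "snd i > 0" if "i \<in> C" for i
    using that C by (auto simp: K_def)
  have W: "open W" "W \<subseteq> U"
    using C by (force simp: W_def K_def)+
  have bij: "bij f" and lin: "linear f"
    using f by (simp_all add: orthogonal_transformation_bij orthogonal_transformation_linear)
  have opn: "open (f ` S)" if "open S" for S
    using that lin bij by (simp add: bij_is_surj open_surjective_linear_image)
  \<comment> \<open>Discarding a null set is needed twice: between \<open>U\<close> and
    \<open>W\<close>, and between their images.\<close>
  have null: "emeasure lborel A = emeasure lborel B"
    if "open A" "open B" "B \<subseteq> A" "negligible (A - B)" for A B :: "'a set"
  proof -
    have "A - B \<in> null_sets lborel"
      using that by (auto simp: negligible_iff_null_sets null_sets_def)
    then have "emeasure lborel (B \<union> (A - B)) = emeasure lborel B"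
      using that by (intro emeasure_Un_null_set) auto
    then show ?thesis
      using that by (simp add: Un_absorb1)
  qed
  have "negligible (f ` (U - W))"
    using neg lin unfolding W_def
    by (intro negligible_differentiable_image_negligible linear_imp_differentiable_on) auto
  then have "emeasure lborel (f ` U) = emeasure lborel (f ` W)"
    using W U opn bij by (intro null) (auto simp: image_set_diff bij_is_inj)
  \<comment> \<open>From here on the measures are sums over \<open>C\<close>, and the measure of a
    ball depends only on its radius.\<close>
  also have "f ` W = (\<Union>i\<in>C. ball (f (fst i)) (snd i))"
    by (simp add: W_def image_UN image_orthogonal_transformation_ball[OF f])
  also have "emeasure lborel \<dots> = (\<integral>\<^sup>+i. emeasure lborel (ball (f (fst i)) (snd i)) \<partial>count_space C)"
  proof (rule emeasure_UN_countable)
    have "pairwise (\<lambda>i j. disjnt (f ` ball (fst i) (snd i)) (f ` ball (fst j) (snd j))) C"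
      using disj bij by (simp add: pairwise_def disjnt_def image_Int[OF bij_is_inj, symmetric])
    then show "disjoint_family_on (\<lambda>i. ball (f (fst i)) (snd i)) C"
      unfolding image_orthogonal_transformation_ball[OF f] pairwise_def disjoint_family_on_def disjnt_def .
  qed (use C in auto)
  also have "\<dots> = (\<integral>\<^sup>+i. emeasure lborel (ball (fst i) (snd i)) \<partial>count_space C)"
    using r by (intro nn_integral_cong) (simp add: emeasure_ball less_imp_le)
  also have "\<dots> = emeasure lborel W"
  proof -
    have "disjoint_family_on (\<lambda>i. ball (fst i) (snd i)) C"
      using disj unfolding pairwise_def disjoint_family_on_def disjnt_def .
    then show ?thesis
      unfolding W_def using C by (intro emeasure_UN_countable[symmetric]) auto
  qed
  also have "\<dots> = emeasure lborel U"
    using null[of U W] W U neg by (simp add: W_def)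
  finally show ?thesis .
qed

text \<open>Lebesgue measure is determined by its values on boxes, and the preimage of a box is its
  image under the inverse map, which is again orthogonal.\<close>

lemma distr_lborel_orthogonal_transformation:
  fixes f :: "'a::euclidean_space \<Rightarrow> 'a"
  assumes f: "orthogonal_transformation f"
  shows "distr lborel borel f = lborel"
proof (rule lborel_eqI[symmetric])
  have [measurable]: "f \<in> borel_measurable borel"
    using f by (intro borel_measurable_continuous_onI linear_continuous_on linear_conv_bounded_linear[THEN iffD1])
      (simp add: orthogonal_transformation_linear)
  fix l u :: 'a assume le: "\<And>b. b \<in> Basis \<Longrightarrow> l \<bullet> b \<le> u \<bullet> b"
  have "emeasure (distr lborel borel f) (box l u) = emeasure lborel (inv f ` box l u)"
    using f by (subst emeasure_distr)
      (auto simp: bij_vimage_eq_inv_image orthogonal_transformation_bij)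
  also have "\<dots> = (\<Prod>b\<in>Basis. (u - l) \<bullet> b)"
    using le f by (subst emeasure_lborel_orthogonal_image_open)
      (auto simp: orthogonal_transformation_inv emeasure_lborel_box)
  finally show "emeasure (distr lborel borel f) (box l u) = (\<Prod>b\<in>Basis. (u - l) \<bullet> b)" .
qed simp

section \<open>The standard Gaussian measure on a Euclidean space\<close>

abbreviation std_normal :: "real measure" where
  "std_normal \<equiv> density lborel (\<lambda>x. ennreal (std_normal_density x))"

text \<open>The product form makes the coordinates independent by construction; the density form
  derived below gives rotation invariance.\<close>

definition std_gaussian :: "'a::euclidean_space measure" where
  "std_gaussian = distr (Pi\<^sub>M Basis (\<lambda>_. std_normal)) borel (\<lambda>f. \<Sum>b\<in>Basis. f b *\<^sub>R b)"

lemma prob_space_std_normal: "prob_space std_normal"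
  by (rule prob_space_normal_density) simp

text \<open>A product measure is determined by its values on rectangles, where the integral of a
  product over separate variables factorises.\<close>

lemma PiM_density_lborel:
  fixes g :: "'i \<Rightarrow> real \<Rightarrow> ennreal"
  assumes I: "finite I" and g[measurable]: "\<And>i. g i \<in> borel_measurable borel"
    and fin: "\<And>i. sigma_finite_measure (density lborel (g i))"
  shows "Pi\<^sub>M I (\<lambda>i. density lborel (g i)) = density (Pi\<^sub>M I (\<lambda>_. lborel)) (\<lambda>x. \<Prod>i\<in>I. g i (x i))"
proof -
  interpret L: product_sigma_finite "\<lambda>_::'i. lborel :: real measure" ..
  interpret D: product_sigma_finite "\<lambda>i. density lborel (g i)"
    using fin by (simp add: product_sigma_finite_def)
  show ?thesis
  proof (rule D.PiM_eqI[symmetric])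
    show "sets (density (Pi\<^sub>M I (\<lambda>_. lborel)) (\<lambda>x. \<Prod>i\<in>I. g i (x i))) = sets (Pi\<^sub>M I (\<lambda>i. density lborel (g i)))"
      by (simp cong: sets_PiM_cong)
    fix A assume "\<And>i. i \<in> I \<Longrightarrow> A i \<in> sets (density lborel (g i))"
    then have A[measurable]: "\<And>i. i \<in> I \<Longrightarrow> A i \<in> sets borel" by simp
    have "emeasure (density (Pi\<^sub>M I (\<lambda>_. lborel)) (\<lambda>x. \<Prod>i\<in>I. g i (x i))) (Pi\<^sub>E I A) =
        (\<integral>\<^sup>+x. (\<Prod>i\<in>I. g i (x i)) * indicator (Pi\<^sub>E I A) x \<partial>Pi\<^sub>M I (\<lambda>_. lborel))"
      using A I by (intro emeasure_density) (auto intro!: sets_PiM_I_finite)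
    also have "\<dots> = (\<integral>\<^sup>+x. (\<Prod>i\<in>I. g i (x i) * indicator (A i) (x i)) \<partial>Pi\<^sub>M I (\<lambda>_. lborel))"
    proof (intro nn_integral_cong)
      \<comment> \<open>The indicator of the rectangle factorises only at extensional
        \<open>x\<close>, because \<open>Pi\<^sub>E\<close> also constrains the values outside
        \<open>I\<close>.\<close>
      fix x assume "x \<in> space (Pi\<^sub>M I (\<lambda>_. lborel :: real measure))"
      then have x: "x \<in> extensional I"
        by (auto simp: space_PiM PiE_def)
      have "indicator (Pi\<^sub>E I A) x = (\<Prod>i\<in>I. indicator (A i) (x i) :: ennreal)"
        using I x by (auto simp: indicator_def PiE_iff prod_zero_iff)
      then show "(\<Prod>i\<in>I. g i (x i)) * indicator (Pi\<^sub>E I A) x = (\<Prod>i\<in>I. g i (x i) * indicator (A i) (x i))"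
        by (simp add: prod.distrib)
    qed
    also have "\<dots> = (\<Prod>i\<in>I. \<integral>\<^sup>+x. g i x * indicator (A i) x \<partial>lborel)"
      using I by (intro L.product_nn_integral_prod) auto
    also have "\<dots> = (\<Prod>i\<in>I. emeasure (density lborel (g i)) (A i))"
      by (intro prod.cong) (auto simp: emeasure_density)
    finally show "emeasure (density (Pi\<^sub>M I (\<lambda>_. lborel)) (\<lambda>x. \<Prod>i\<in>I. g i (x i))) (Pi\<^sub>E I A) = 
      (\<Prod>i\<in>I. emeasure (density lborel (g i)) (A i))" .
  qed (rule I)
qed

text \<open>Multiplying the one-dimensional densities adds the squares in the exponent, so the joint
  density depends on the norm alone.\<close>

lemma std_gaussian_density:
  "(std_gaussian :: 'a::euclidean_space measure) =
     density lborel (\<lambda>x. ennreal ((1 / sqrt (2 * pi)) ^ DIM('a) * exp (- (norm x)\<^sup>2 / 2)))"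
proof -
  have prod: "(\<Prod>b\<in>Basis. ennreal (std_normal_density (f b))) =
      ennreal ((1 / sqrt (2 * pi)) ^ DIM('a) * exp (- (norm (\<Sum>b\<in>Basis. f b *\<^sub>R b :: 'a))\<^sup>2 / 2))"
    for f :: "'a \<Rightarrow> real"
  proof -
    have "(norm (\<Sum>b\<in>Basis. f b *\<^sub>R b :: 'a))\<^sup>2 = (\<Sum>b\<in>Basis. (f b)\<^sup>2)"
      unfolding power2_norm_eq_inner by (subst euclidean_inner) (simp add: power2_eq_square)
    moreover have "(\<Prod>b\<in>(Basis :: 'a set). exp (- (f b)\<^sup>2 / 2)) = exp (- (\<Sum>b\<in>Basis. (f b)\<^sup>2) / 2)"
      by (subst exp_sum[symmetric]) (simp_all add: sum_negf sum_divide_distrib)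
    ultimately show ?thesis
      unfolding std_normal_density_def by (subst prod_ennreal) (simp_all add: prod_dividef power_one_over)
  qed
  have "std_gaussian = distr (density (Pi\<^sub>M Basis (\<lambda>_. lborel))
      (\<lambda>f. \<Prod>b\<in>Basis. ennreal (std_normal_density (f b)))) borel (\<lambda>f. \<Sum>b\<in>Basis. f b *\<^sub>R b :: 'a)"
    unfolding std_gaussian_def using prob_space_std_normal
    by (subst PiM_density_lborel) (auto intro: prob_space_imp_sigma_finite)
  also have "\<dots> = density lborel (\<lambda>x. ennreal ((1 / sqrt (2 * pi)) ^ DIM('a) * exp (- (norm x)\<^sup>2 / 2)))"
    unfolding prod by (subst density_distr[symmetric]) (simp_all add: lborel_eq[symmetric])
  finally show ?thesis .
qed

lemma distr_std_gaussian_orthogonal_transformation: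
  fixes f :: "'a::euclidean_space \<Rightarrow> 'a"
  assumes f: "orthogonal_transformation f"
  shows "distr std_gaussian borel f = std_gaussian"
proof -
  let ?g = "\<lambda>x::'a. ennreal ((1 / sqrt (2 * pi)) ^ DIM('a) * exp (- (norm x)\<^sup>2 / 2))"
  have [measurable]: "f \<in> borel_measurable borel"
    using f by (intro borel_measurable_continuous_onI linear_continuous_on linear_conv_bounded_linear[THEN iffD1])
      (simp add: orthogonal_transformation_linear)
  have "density (distr lborel borel f) ?g = distr (density lborel (\<lambda>x. ?g (f x))) borel f"
    by (rule density_distr) auto
  then show ?thesis
    using f by (simp add: std_gaussian_density distr_lborel_orthogonal_transformation orthogonal_transformation_norm)
qed

lemma sets_std_gaussian[simp, measurable_cong]: "sets std_gaussian = sets borel"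
  and space_std_gaussian[simp]: "space std_gaussian = UNIV"
  by (simp_all add: std_gaussian_def)

text \<open>The coordinates in \<open>J\<close> form a marginal of the product measure; renumbering
  \<open>J\<close> by \<open>{..<card J}\<close> gives the product that defines
  \<open>chi_squared\<close>.\<close>

lemma distr_sum_squares_std_gaussian:
  assumes J: "J \<subseteq> (Basis :: 'a::euclidean_space set)"
  shows "distr std_gaussian borel (\<lambda>x::'a. \<Sum>b\<in>J. (x \<bullet> b)\<^sup>2) = chi_squared (card J)"
proof -
  have finJ: "finite J"
    using J finite_Basis finite_subset by blast
  obtain h where h: "bij_betw h {..<card J} J"
    using finite_same_card_bij[of "{..<card J}" J] finJ by auto
  let ?P = "Pi\<^sub>M Basis (\<lambda>_::'a. std_normal)"
  let ?R = "\<lambda>\<omega>. \<lambda>n\<in>{..<card J}. \<omega> (h n)"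
  have hm[measurable]: "?R \<in> measurable ?P (Pi\<^sub>M {..<card J} (\<lambda>_. std_normal))"
    using h J by (intro measurable_restrict measurable_component_singleton) (auto simp: bij_betw_def)
  have "distr std_gaussian borel (\<lambda>x::'a. \<Sum>b\<in>J. (x \<bullet> b)\<^sup>2) = distr ?P borel (\<lambda>f. \<Sum>b\<in>J. (f b)\<^sup>2)"
    unfolding std_gaussian_def using J
    by (subst distr_distr) (auto simp: comp_def subset_iff intro!: distr_cong sum.cong)
  also have "\<dots> = distr ?P borel (\<lambda>f. \<Sum>i<card J. (?R f i)\<^sup>2)"
    by (intro distr_cong) (auto simp: sum.reindex_bij_betw[OF h, of "\<lambda>b. (_ b)\<^sup>2", symmetric])
  also have "\<dots> = distr (distr ?P (Pi\<^sub>M {..<card J} (\<lambda>_. std_normal)) ?R) borel (\<lambda>x. \<Sum>i<card J. (x i)\<^sup>2)"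
    by (subst distr_distr) (auto simp: comp_def)
  also have "distr ?P (Pi\<^sub>M {..<card J} (\<lambda>_. std_normal)) ?R = Pi\<^sub>M {..<card J} (\<lambda>_. std_normal)"
    using h J prob_space_std_normal
    by (intro distr_PiM_reindex) (auto simp: bij_betw_def)
  finally show ?thesis
    by (simp add: chi_squared_def)
qed

section \<open>Projections of a standard Gaussian vector\<close>

text \<open>Orthonormal bases of \<open>S\<close> and of its orthogonal complement together form one
  of the whole space. Indexing it by \<open>Basis\<close> prepares a rotation that carries the
  vectors in \<open>J\<close> to a basis of \<open>S\<close>.\<close>

lemma adapted_orthonormal_basis:
  fixes S :: "'a::euclidean_space set"
  assumes S: "subspace S"
  obtains e :: "'a \<Rightarrow> 'a" and J where "J \<subseteq> Basis" "card J = dim S" "span (e ` J) = S"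
    "\<And>b c. b \<in> Basis \<Longrightarrow> c \<in> Basis \<Longrightarrow> e b \<bullet> e c = (if b = c then 1 else 0)"
proof -
  let ?S' = "{y. \<forall>x\<in>S. orthogonal x y}"
  have S': "subspace ?S'"
    by (rule subspace_orthogonal_to_vectors)
  obtain B where B: "B \<subseteq> S" "pairwise orthogonal B" "\<And>x. x \<in> B \<Longrightarrow> norm x = 1"
      "independent B" "card B = dim S" "span B = S"
    by (rule orthonormal_basis_subspace[OF S]) (rule that)
  obtain B' where B': "B' \<subseteq> ?S'" "pairwise orthogonal B'" "\<And>x. x \<in> B' \<Longrightarrow> norm x = 1"
      "independent B'" "card B' = dim ?S'"
      "span B' = ?S'"
    by (rule orthonormal_basis_subspace[OF S']) (rule that)
  have dim: "dim ?S' + dim S = DIM('a)"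
    using dim_subspace_orthogonal_to_vectors[OF S subspace_UNIV] by simp
  obtain J where J: "J \<subseteq> (Basis :: 'a set)" "card J = dim S"
    by (rule obtain_subset_with_card_n[OF dim_subset_UNIV[of S]]) (rule that)
  have fin: "finite J" "finite B" "finite B'"
    using finite_subset[OF J(1)] independent_imp_finite[OF B(4)] independent_imp_finite[OF B'(4)] by auto
  have "card (Basis - J) = dim ?S'"
    using J dim fin by (simp add: card_Diff_subset)
  then obtain g h where g: "bij_betw g J B" and h: "bij_betw h (Basis - J) B'"
    using finite_same_card_bij[of J B] finite_same_card_bij[of "Basis - J" B'] J B(5) B'(5) fin by auto
  define e where "e = (\<lambda>b. if b \<in> J then g b else h b)"
  have gJ: "g b \<in> B" if "b \<in> J" for b
    using g that by (auto simp: bij_betw_def)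
  have hJ: "h b \<in> B'" if "b \<in> Basis - J" for b
    using h that by (auto simp: bij_betw_def)
  have "e ` J = B"
    using g by (auto simp: e_def bij_betw_def)
  moreover have "e b \<bullet> e c = (if b = c then 1 else 0)" if bc: "b \<in> Basis" "c \<in> Basis" for b c
  proof -
    have "norm (e b) = 1"
      using gJ hJ bc B(3) B'(3) by (simp add: e_def)
    moreover have "e b \<bullet> e c = 0" if "b \<noteq> c"
    \<comment> \<open>Within one half, distinct basis vectors are orthogonal by choice; across the
      halves, one vector lies in \<open>S\<close> and the other in its complement.\<close>
    proof (cases "b \<in> J \<longleftrightarrow> c \<in> J")
      case True
      then have "e b \<noteq> e c"
        using g h bc that by (auto simp: e_def bij_betw_def inj_on_def)
      then show ?thesis
        using True B(2) B'(2) gJ hJ bc by (auto simp: e_def pairwise_def orthogonal_def)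
    next
      case False
      then have "(e b \<in> S \<and> e c \<in> ?S') \<or> (e b \<in> ?S' \<and> e c \<in> S)"
        using gJ[THEN subsetD[OF B(1)]] hJ[THEN subsetD[OF B'(1)]] bc by (auto simp: e_def)
      then show ?thesis
        by (auto simp: orthogonal_def inner_commute)
    qed
    ultimately show ?thesis
      by (auto simp: norm_eq_1)
  qed
  ultimately show ?thesis
    using that J B(6) by metis
qed

text \<open>\<open>T\<close> maps the standard basis to \<open>e\<close>. It turns standard
  coordinates into coordinates along \<open>e\<close>, and so preserves inner products.\<close>

lemma rotation_coordinates:
  fixes e :: "'a::euclidean_space \<Rightarrow> 'a"
  assumes e: "\<And>b c. b \<in> Basis \<Longrightarrow> c \<in> Basis \<Longrightarrow> e b \<bullet> e c = (if b = c then 1 else 0)"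
  defines "T \<equiv> \<lambda>x. \<Sum>b\<in>Basis. (x \<bullet> b) *\<^sub>R e b"
  shows "orthogonal_transformation T" and "b \<in> Basis \<Longrightarrow> T x \<bullet> e b = x \<bullet> b"
proof -
  show coord: "T x \<bullet> e b = x \<bullet> b" if "b \<in> Basis" for x b
    using that by (simp add: T_def inner_sum_left e if_distrib cong: if_cong)
  have "linear T"
    unfolding T_def by (intro linearI) (simp_all add: inner_add_left scaleR_add_left sum.distrib scaleR_sum_right)
  moreover have "T x \<bullet> T y = x \<bullet> y" for x y
  proof -
    have "T x \<bullet> T y = (\<Sum>b\<in>Basis. (y \<bullet> b) * (T x \<bullet> e b))"
      by (subst (2) T_def) (simp add: inner_sum_right)
    also have "\<dots> = x \<bullet> y"
      by (simp add: coord euclidean_inner[of x y] mult.commute)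
    finally show ?thesis .
  qed
  ultimately show "orthogonal_transformation T"
    by (simp add: orthogonal_transformation_def)
qed

text \<open>Because \<open>x - p\<close> is orthogonal to the span, \<open>x\<close> and
  \<open>p\<close> have the same coordinates along \<open>e\<close>; Parseval's identity for
  \<open>p\<close> then gives the sum.\<close>

lemma norm_orthogonal_projection_eq_sum:
  fixes e :: "'i \<Rightarrow> 'a::euclidean_space"
  assumes J: "finite J" and e: "\<And>b c. b \<in> J \<Longrightarrow> c \<in> J \<Longrightarrow> e b \<bullet> e c = (if b = c then 1 else 0)"
    and p: "p \<in> span (e ` J)" and orth: "\<And>y. y \<in> span (e ` J) \<Longrightarrow> (x - p) \<bullet> y = 0"
  shows "(norm p)\<^sup>2 = (\<Sum>b\<in>J. (x \<bullet> e b)\<^sup>2)"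
proof -
  have inj: "inj_on e J"
    using e by (metis inj_onI zero_neq_one)
  have coord: "p \<bullet> e b = x \<bullet> e b" if "b \<in> J" for b
    using orth[of "e b"] that by (simp add: span_base inner_diff_left)
  have "pairwise orthogonal (e ` J)"
    by (auto simp: pairwise_def orthogonal_def e)
  moreover have "norm i = 1" if "i \<in> e ` J" for i
    using that e by (auto simp: norm_eq_1)
  ultimately have "(\<Sum>i\<in>e ` J. (p \<bullet> i) *\<^sub>R i) = p"
    using p J by (intro orthonormal_basis_expand) auto
  then have "p = (\<Sum>b\<in>J. (p \<bullet> e b) *\<^sub>R e b)"
    by (simp add: sum.reindex[OF inj])
  then have "p \<bullet> p = (\<Sum>b\<in>J. (p \<bullet> e b) * (p \<bullet> e b))"
    by (metis (no_types, lifting) inner_scaleR_right inner_sum_right sum.cong)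
  then show ?thesis
    unfolding power2_norm_eq_inner by (simp add: power2_eq_square coord)
qed

text \<open>Replacing \<open>x\<close> by \<open>T x\<close> leaves the Gaussian law unchanged and
  turns the squared norm of the projection into a sum of \<open>dim S\<close> squared standard
  coordinates.\<close>

lemma distr_norm_projection_std_gaussian:
  fixes p :: "'a::euclidean_space \<Rightarrow> 'a"
  assumes S: "subspace S" and p[measurable]: "p \<in> borel_measurable borel"
    and p_in: "\<And>x. p x \<in> S" and p_orth: "\<And>x y. y \<in> S \<Longrightarrow> (x - p x) \<bullet> y = 0"
  shows "distr std_gaussian borel (\<lambda>x. (norm (p x))\<^sup>2) = chi_squared (dim S)"
proof -
  obtain e :: "'a \<Rightarrow> 'a" and J where J: "J \<subseteq> Basis" "card J = dim S" "span (e ` J) = S"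
    and e: "\<And>b c. b \<in> Basis \<Longrightarrow> c \<in> Basis \<Longrightarrow> e b \<bullet> e c = (if b = c then 1 else 0)"
    by (rule adapted_orthonormal_basis[OF S]) (rule that)
  define T where "T x = (\<Sum>b\<in>Basis. (x \<bullet> b) *\<^sub>R e b)" for x
  have T: "orthogonal_transformation T" and coord: "T x \<bullet> e b = x \<bullet> b" if "b \<in> Basis" for x b
    using rotation_coordinates[OF e] that unfolding T_def by blast+
  have [measurable]: "T \<in> borel_measurable borel"
    unfolding T_def by measurable
  have "(norm (p (T x)))\<^sup>2 = (\<Sum>b\<in>J. (x \<bullet> b)\<^sup>2)" for x
  proof -
    have "(norm (p (T x)))\<^sup>2 = (\<Sum>b\<in>J. (T x \<bullet> e b)\<^sup>2)"
      using J e p_in p_orth by (intro norm_orthogonal_projection_eq_sum) (auto simp: finite_subset subset_iff)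
    also have "\<dots> = (\<Sum>b\<in>J. (x \<bullet> b)\<^sup>2)"
      using J(1) by (intro sum.cong) (auto simp: coord)
    finally show ?thesis .
  qed
  then have "distr std_gaussian borel (\<lambda>x. (norm (p (T x)))\<^sup>2) = chi_squared (dim S)"
    using distr_sum_squares_std_gaussian[OF J(1)] J(2) by simp
  moreover have "distr (distr std_gaussian borel T) borel (\<lambda>x. (norm (p x))\<^sup>2) =
      distr std_gaussian borel (\<lambda>x. (norm (p (T x)))\<^sup>2)"
    by (subst distr_distr) (simp_all add: comp_def)
  ultimately show ?thesis
    \<comment> \<open>The fact \<open>T\<close> was obtained under the premise
      \<open>b \<in> Basis\<close>, so some basis vector has to be supplied.\<close>
    using T[OF SOME_Basis] by (simp add: distr_std_gaussian_orthogonal_transformation)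
qed

text \<open>Independence gives a product measure indexed by \<open>'k\<close>, while
  \<open>std_gaussian\<close> is indexed by \<open>Basis\<close>; the bijection \<open>i\<close> to
  \<open>axis i 1\<close> carries one to the other.\<close>

lemma (in prob_space) distr_vec_std_gaussian:
  fixes X :: "'k::finite \<Rightarrow> 'a \<Rightarrow> real"
  assumes normal: "\<And>i. distributed M lborel (X i) (\<lambda>x. ennreal (std_normal_density x))"
    and indep: "indep_vars (\<lambda>_. borel) X UNIV"
  shows "distr M borel (\<lambda>\<omega>. \<chi> i. X i \<omega>) = std_gaussian"
proof -
  have X[measurable]: "X i \<in> borel_measurable M" for i
    using distributed_measurable[OF normal[of i]] by simp
  have "distr M borel (X i) = std_normal" for i
    using distributed_distr_eq_density[OF normal[of i]] by (simp cong: distr_cong)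
  then have joint: "distr M (Pi\<^sub>M UNIV (\<lambda>_. borel)) (\<lambda>\<omega> i. X i \<omega>) = Pi\<^sub>M UNIV (\<lambda>_. std_normal)"
    using indep_vars_iff_distr_eq_PiM[THEN iffD1, OF _ X indep] by (simp add: restrict_UNIV)
  define k :: "real ^ 'k \<Rightarrow> 'k" where "k = inv (\<lambda>i. axis i 1)"
  have inj: "inj (\<lambda>i::'k. axis i (1::real))"
    by (auto simp: inj_def axis_eq_axis)
  have k: "k (axis i 1) = i" for i
    unfolding k_def by (rule inv_f_f[OF inj])
  have Basis: "(Basis :: (real ^ 'k) set) = range (\<lambda>i. axis i 1)"
    by (auto simp: Basis_vec_def)
  have sum: "(\<Sum>b\<in>Basis. x (k b) *\<^sub>R b) = (\<chi> i. x i)" for x :: "'k \<Rightarrow> real"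
  proof -
    have "(\<Sum>b\<in>Basis. x (k b) *\<^sub>R b) = (\<Sum>i\<in>UNIV. x i *\<^sub>R axis i 1)"
      by (simp add: Basis sum.reindex[OF inj] k)
    also have "\<dots> = (\<chi> i. x i)"
      by (simp add: vec_eq_iff axis_def if_distrib cong: if_cong)
    finally show ?thesis .
  qed
  let ?P = "Pi\<^sub>M UNIV (\<lambda>_::'k. std_normal)" and ?B = "Pi\<^sub>M (Basis :: (real ^ 'k) set) (\<lambda>_. std_normal)"
  have vec[measurable]: "(\<lambda>x. \<chi> i. x i) \<in> borel_measurable (Pi\<^sub>M UNIV (\<lambda>_::'k. borel :: real measure))"
    unfolding sum[symmetric] by measurable
  have re[measurable]: "(\<lambda>x. \<lambda>b\<in>Basis. x (k b)) \<in> measurable ?P ?B"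
    by (intro measurable_restrict measurable_component_singleton) auto
  have "std_gaussian = distr (distr ?P ?B (\<lambda>x. \<lambda>b\<in>Basis. x (k b))) borel (\<lambda>f. \<Sum>b\<in>Basis. f b *\<^sub>R b)"
    unfolding std_gaussian_def using prob_space_std_normal
    by (subst distr_PiM_reindex) (auto simp: inj_on_def Basis k)
  also have "\<dots> = distr ?P borel (\<lambda>x. \<chi> i. x i)"
    by (subst distr_distr) (auto simp: comp_def sum[symmetric] intro!: distr_cong sum.cong)
  also have "\<dots> = distr M borel (\<lambda>\<omega>. \<chi> i. X i \<omega>)"
    unfolding joint[symmetric] by (subst distr_distr) (auto simp: comp_def intro!: measurable_PiM_single')
  finally show ?thesis ..
qed

section \<open>Weighted least squares\<close>

lemma matrix_mul_matrix_inv: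
  assumes "invertible A"
  shows "A ** matrix_inv A = mat 1"
  using someI_ex[OF assms[unfolded invertible_def]] by (simp add: matrix_inv_def)

text \<open>If the Gram matrix kills \<open>x\<close>, then the squared norm of
  \<open>B *v x\<close> is zero.\<close>

lemma invertible_gram_matrix:
  fixes B :: "real ^ 'm::finite ^ 'k::finite"
  assumes "inj ((*v) B)"
  shows "invertible (transpose B ** B)"
proof -
  have "x = 0" if "(transpose B ** B) *v x = 0" for x
  proof -
    have "(B *v x) \<bullet> (B *v x) = x \<bullet> ((transpose B ** B) *v x)"
      by (metis dot_lmul_matrix matrix_vector_mul_assoc transpose_matrix_vector inner_commute)
    then have "B *v x = B *v 0"
      using that by simp
    then show "x = 0"
      using assms by (rule injD[rotated])
  qed
  then show ?thesis
    by (simp add: invertible_left_inverse matrix_left_invertible_ker)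
qed

text \<open>For symmetric \<open>D\<close> this is the usual orthogonal projection formula for the
  matrix \<open>D ** A\<close>.\<close>

lemma lsq_projection_altdef:
  fixes A :: "real ^ 'm::finite ^ 'k::finite"
  assumes "transpose D = D"
  shows "lsq_projection D A =
    (D ** A) ** matrix_inv (transpose (D ** A) ** (D ** A)) ** transpose (D ** A)"
  using assms by (simp add: lsq_projection_def matrix_transpose_mul matrix_mul_assoc)

lemma lsq_projection_in_range:
  fixes A :: "real ^ 'm::finite ^ 'k::finite"
  assumes "transpose D = D"
  shows "lsq_projection D A *v y \<in> range ((*v) (D ** A))"
  by (simp add: lsq_projection_altdef[OF assms] matrix_vector_mul_assoc[symmetric])

context
  fixes D :: "real ^ 'k::finite ^ 'k" and A :: "real ^ 'm::finite ^ 'k"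
  assumes D: "transpose D = D" and inj: "inj ((*v) (D ** A))"
begin

text \<open>These are the normal equations: multiplying by the transpose of \<open>D ** A\<close>
  cancels the Gram matrix against its inverse.\<close>

lemma lsq_projection_orthogonal: "(y - lsq_projection D A *v y) \<bullet> ((D ** A) *v \<beta>) = 0"
proof -
  let ?B = "D ** A"
  have "transpose ?B *v (lsq_projection D A *v y) =
      ((transpose ?B ** ?B) ** matrix_inv (transpose ?B ** ?B)) *v (transpose ?B *v y)"
    unfolding lsq_projection_altdef[OF D] by (simp only: matrix_vector_mul_assoc matrix_mul_assoc)
  also have "\<dots> = transpose ?B *v y"
    using invertible_gram_matrix[OF inj] by (simp add: matrix_mul_matrix_inv)
  finally have "transpose ?B *v (y - lsq_projection D A *v y) = 0"
    by (simp add: matrix_vector_mult_diff_distrib)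
  then show ?thesis
    by (metis dot_lmul_matrix transpose_matrix_vector inner_zero_left)
qed

text \<open>The difference of the two sides lies in the range and is orthogonal to it.\<close>

lemma lsq_projection_fixes_range: "lsq_projection D A *v ((D ** A) *v \<beta>) = (D ** A) *v \<beta>"
proof -
  let ?y = "(D ** A) *v \<beta>"
  obtain \<gamma> where "lsq_projection D A *v ?y = (D ** A) *v \<gamma>"
    using lsq_projection_in_range[OF D] by blast
  then have "?y - lsq_projection D A *v ?y = (D ** A) *v (\<beta> - \<gamma>)"
    by (simp add: matrix_vector_mult_diff_distrib)
  then have "(?y - lsq_projection D A *v ?y) \<bullet> (?y - lsq_projection D A *v ?y) = 0"
    using lsq_projection_orthogonal[of ?y "\<beta> - \<gamma>"] by metis
  then show ?thesis
    by simp
qed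

lemma weighted_lsq_fitted: "(D ** A) *v weighted_lsq D A u = lsq_projection D A *v (D *v u)"
proof -
  let ?y = "D *v u" and ?f = "\<lambda>\<beta>. (norm ((D ** A) *v \<beta> - D *v u))\<^sup>2"
  obtain \<gamma> where \<gamma>: "lsq_projection D A *v ?y = (D ** A) *v \<gamma>"
    using lsq_projection_in_range[OF D] by blast
  \<comment> \<open>Pythagoras shows that \<open>\<gamma>\<close> is a minimiser, and that any
    \<open>\<beta>\<close> with the same value of \<open>?f\<close> has the same fitted
    vector.\<close>
  have pyth: "?f \<beta> = ?f \<gamma> + (norm ((D ** A) *v \<beta> - (D ** A) *v \<gamma>))\<^sup>2" for \<beta>
  proof -
    have "orthogonal (?y - (D ** A) *v \<gamma>) ((D ** A) *v (\<gamma> - \<beta>))"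
      using lsq_projection_orthogonal[of ?y "\<gamma> - \<beta>"] by (simp add: orthogonal_def \<gamma>)
    from norm_add_Pythagorean[OF this] show ?thesis
      by (simp add: matrix_vector_mult_diff_distrib norm_minus_commute)
  qed
  have "?f \<gamma> \<le> ?f \<beta>" for \<beta>
    by (subst (2) pyth) simp
  \<comment> \<open>The existence of the minimiser \<open>\<gamma>\<close> ensures that the choice
    made by \<open>ARG_MIN\<close> attains the minimum.\<close>
  then have "?f (weighted_lsq D A u) = ?f \<gamma>"
    unfolding weighted_lsq_def by (intro arg_min_equality) auto
  then have "(norm ((D ** A) *v weighted_lsq D A u - (D ** A) *v \<gamma>))\<^sup>2 = 0"
    using pyth[of "weighted_lsq D A u"] by linarith
  then show ?thesis
    by (simp add: \<gamma>)
qed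

lemma rescaled_residual_eq:
  "rescaled_residual D A u = - ((mat 1 - lsq_projection D A) *v (D *v u))"
  by (simp add: rescaled_residual_def weighted_lsq_fitted matrix_vector_mult_diff_rdistrib)

end

section \<open>The concrete weight and design matrices\<close>

lemma diag_matrix_mult_vec: "diag_matrix v *v x = (\<chi> i. v i * x $ i)"
  by (simp add: vec_eq_iff diag_matrix_def matrix_vector_mult_def if_distrib[of "\<lambda>a. a * _"] cong: if_cong)

lemma transpose_diag_matrix: "transpose (diag_matrix v) = diag_matrix v"
  by (auto simp: vec_eq_iff diag_matrix_def transpose_def)

lemma inj_design_matrix:
  fixes eps :: "'k::finite \<Rightarrow> real"
  assumes eps: "inj eps" "\<And>i. eps i \<noteq> 0" and K: "CARD('k) \<ge> 3"
  shows "inj ((*v) (design_matrix eps))"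
proof -
  have "\<beta> = 0" if "design_matrix eps *v \<beta> = 0" for \<beta> :: "real ^ 3"
  proof -
    \<comment> \<open>Row \<open>i\<close> of the kernel equation, multiplied by
      \<open>eps i\<close>, says that this polynomial vanishes at \<open>eps i\<close>.\<close>
    define p where "p = [:- \<beta> $ 1, \<beta> $ 2, \<beta> $ 3:]"
    have "poly p (eps i) = 0" for i
    proof -
      have "- \<beta> $ 1 / eps i + \<beta> $ 2 + eps i * \<beta> $ 3 = 0"
        using that by (simp add: vec_eq_iff design_matrix_def matrix_vector_mult_def sum_3)
      then show ?thesis
        using eps(2)[of i] by (simp add: p_def field_simps)
    qed
    then have roots: "range eps \<subseteq> {x. poly p x = 0}"
      by auto
    have "p = 0"
    proof (rule ccontr)
      assume "p \<noteq> 0"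
      have "3 \<le> card (range eps)"
        using K eps(1) by (simp add: card_image)
      also have "\<dots> \<le> card {x. poly p x = 0}"
        using roots poly_roots_finite[OF \<open>p \<noteq> 0\<close>] by (intro card_mono)
      also have "\<dots> \<le> degree p"
        using card_poly_roots_bound[OF \<open>p \<noteq> 0\<close>] .
      also have "\<dots> \<le> 2"
        by (simp add: p_def)
      finally show False
        by simp
    qed
    then show ?thesis
      by (simp add: p_def vec_eq_iff forall_3)
  qed
  then show ?thesis
    by (metis matrix_left_invertible_ker matrix_left_invertible_injective)
qed

text \<open>The weights are the reciprocals of the standard deviations of the sampling errors;
  strict bounds on \<open>N0 i\<close> keep both factors under the roots positive.\<close>

lemma weight_matrix_sampling_error:
  assumes "\<And>i. 0 < N0 i \<and> N0 i < N"
  shows "weight_matrix N N0 *v sampling_error N N0 \<zeta> \<omega> = (\<chi> i. \<zeta> i \<omega>)"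
proof -
  have cancel: "sqrt (inverse a * b) * sqrt (a * inverse b) = 1" if "0 < a" "0 < b" for a b :: real
    using that by (simp add: real_sqrt_mult[symmetric] field_simps)
  have "sqrt (inverse (1 - real (N0 i) / real N) * real (N0 i)) *
      sqrt ((1 - real (N0 i) / real N) * inverse (real (N0 i))) = 1" for i
    using assms[of i] by (intro cancel) (auto simp: field_simps)
  then show ?thesis
    by (simp add: weight_matrix_def sampling_error_def diag_matrix_mult_vec vec_eq_iff mult.assoc[symmetric])
qed

lemma inj_weight_matrix:
  assumes "\<And>i. 0 < N0 i \<and> N0 i < N"
  shows "inj ((*v) (weight_matrix N N0))"
proof (rule injI)
  fix x y assume "weight_matrix N N0 *v x = weight_matrix N N0 *v y"
  moreover have "inverse (1 - real (N0 i) / real N) * real (N0 i) > 0" for i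
    using assms[of i] by (auto simp: field_simps)
  ultimately show "x = y"
    by (simp add: weight_matrix_def diag_matrix_mult_vec vec_eq_iff) (metis assms less_irrefl)
qed

section \<open>Decomposition of the rescaled residual\<close>

theorem proposition2:
  fixes M :: "'w measure"
    and eps :: "'k::finite \<Rightarrow> real"
    and N :: nat and N0 :: "'k \<Rightarrow> nat"
    and V Z0 Z1 :: "real ^ 'n \<Rightarrow> real" and C1 :: real and xstar :: "real ^ 'n"
    and \<zeta> :: "'k \<Rightarrow> 'w \<Rightarrow> real"
    and s1 u :: "'w \<Rightarrow> real ^ 'k"
    and C :: real
  assumes M: "prob_space M"
    and K: "CARD('k) > 3"
    and eps_pos: "\<And>i. eps i > 0"
    and eps_distinct: "inj eps"
    and N0_bounds: "\<And>i. 0 < N0 i \<and> N0 i < N"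
    and Z0_pos: "Z0 xstar > 0"
    and normal: "\<And>i. distributed M lborel (\<zeta> i) (\<lambda>x. ennreal (std_normal_density x))"
    and indep: "prob_space.indep_vars M (\<lambda>_. borel) \<zeta> UNIV"
    and s1_measurable: "s1 \<in> borel_measurable M"
    and s1_bound: "\<And>\<omega>. \<omega> \<in> space M \<Longrightarrow> norm (s1 \<omega>) \<le> C * (Max (range eps))\<^sup>2"
    and model: "\<And>\<omega>. \<omega> \<in> space M \<Longrightarrow>
      u \<omega> = design_matrix eps *v true_values V Z0 Z1 C1 xstar + sampling_error N N0 \<zeta> \<omega> + s1 \<omega>"
  shows "\<exists>r0 r1.
    r0 \<in> borel_measurable M \<and> r1 \<in> borel_measurable M \<and>
    (\<forall>\<omega>\<in>space M.
       rescaled_residual (weight_matrix N N0) (design_matrix eps) (u \<omega>) = r0 \<omega> + r1 \<omega>) \<and>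
    distr M borel (\<lambda>\<omega>. (norm (r0 \<omega>))\<^sup>2) = chi_squared (CARD('k) - 3) \<and>
    (\<forall>\<omega>\<in>space M.
       norm (r1 \<omega>) \<le> C * (Max (range eps))\<^sup>2 *
         onorm ((*v) ((mat 1 - lsq_projection (weight_matrix N N0) (design_matrix eps))
                       ** weight_matrix N N0)))"
proof -
  interpret prob_space M by (rule M)
  let ?D = "weight_matrix N N0" and ?A = "design_matrix eps"
  let ?P = "lsq_projection ?D ?A"
  let ?Q = "mat 1 - ?P"
  let ?z = "\<lambda>\<omega>. (\<chi> i. \<zeta> i \<omega>) :: real ^ 'k"
  let ?R = "range ((*v) (?D ** ?A))"
  \<comment> \<open>\<open>S\<close> is the space of possible residuals, onto which
    \<open>?Q\<close> projects orthogonally.\<close>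
  define S where "S = {y. \<forall>x\<in>?R. orthogonal x y}"
  have D: "transpose ?D = ?D"
    by (simp add: weight_matrix_def transpose_diag_matrix)
  have "inj ((*v) ?A)"
    using K eps_distinct eps_pos by (intro inj_design_matrix) (auto simp: less_imp_neq[symmetric])
  moreover have "inj ((*v) ?D)"
    using N0_bounds by (rule inj_weight_matrix)
  ultimately have inj: "inj ((*v) (?D ** ?A))"
    by (simp add: inj_def matrix_vector_mul_assoc[symmetric])
  have [measurable]: "(*v) B \<in> borel_measurable borel" for B :: "real ^ 'k ^ 'k"
    by (intro borel_measurable_continuous_onI matrix_vector_mult_linear_continuous_on)
  have z: "distr M borel ?z = std_gaussian"
    by (rule distr_vec_std_gaussian[OF normal indep])
  have [measurable]: "\<zeta> i \<in> borel_measurable M" for i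
    using distributed_measurable[OF normal[of i]] by simp
  have [measurable]: "?z \<in> borel_measurable M"
    by (subst borel_measurable_euclidean_space) (auto simp: Basis_vec_def inner_axis)
  have Q: "?Q *v x = x - ?P *v x" for x
    by (simp add: matrix_vector_mult_diff_rdistrib)
  have S: "subspace S"
    unfolding S_def by (rule subspace_orthogonal_to_vectors)
  have R: "subspace ?R"
    by (rule linear_subspace_image) simp_all
  have "dim ?R = 3"
    using dim_image_eq[of "(*v) (?D ** ?A)" UNIV] inj by simp
  then have dim: "dim S = CARD('k) - 3"
    using dim_subspace_orthogonal_to_vectors[OF R subspace_UNIV] by (simp add: S_def)
  have "distr std_gaussian borel (\<lambda>x. (norm (?Q *v x))\<^sup>2) = chi_squared (dim S)"
  proof (rule distr_norm_projection_std_gaussian[OF S])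
    fix x y :: "real ^ 'k"
    show "?Q *v x \<in> S"
      using lsq_projection_orthogonal[OF D inj]
      by (auto simp: S_def Q orthogonal_def inner_commute)
    \<comment> \<open>Here \<open>x - ?Q *v x\<close> is \<open>?P *v x\<close>, a vector in the
      range \<open>?R\<close>.\<close>
    assume "y \<in> S"
    then show "(x - ?Q *v x) \<bullet> y = 0"
      using lsq_projection_in_range[OF D, of ?A x] by (auto simp: S_def Q orthogonal_def)
  qed simp
  moreover have "distr (distr M borel ?z) borel (\<lambda>x. (norm (?Q *v x))\<^sup>2) =
      distr M borel (\<lambda>\<omega>. (norm (- (?Q *v ?z \<omega>)))\<^sup>2)"
    by (subst distr_distr) (simp_all add: comp_def)
  ultimately have chi: "distr M borel (\<lambda>\<omega>. (norm (- (?Q *v ?z \<omega>)))\<^sup>2) = chi_squared (CARD('k) - 3)"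
    by (simp add: z dim)
  \<comment> \<open>The two summands are the witnesses for \<open>r0\<close> and \<open>r1\<close>.
    The sign comes from taking fit minus data, and the norms absorb it.\<close>
  have "rescaled_residual ?D ?A (u \<omega>) = - (?Q *v ?z \<omega>) + - ((?Q ** ?D) *v s1 \<omega>)"
    if "\<omega> \<in> space M" for \<omega>
  proof -
    let ?\<beta> = "true_values V Z0 Z1 C1 xstar"
    have "?D *v u \<omega> = (?D ** ?A) *v ?\<beta> + ?z \<omega> + ?D *v s1 \<omega>"
      using model[OF that] weight_matrix_sampling_error[OF N0_bounds]
      by (simp add: matrix_vector_right_distrib matrix_vector_mul_assoc)
    moreover have "?Q *v ((?D ** ?A) *v ?\<beta>) = 0"
      by (simp add: Q lsq_projection_fixes_range[OF D inj])
    ultimately show ?thesis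
      by (simp add: rescaled_residual_eq[OF D inj] matrix_vector_right_distrib matrix_vector_mul_assoc)
  qed
  moreover have "norm (- ((?Q ** ?D) *v s1 \<omega>)) \<le>
      C * (Max (range eps))\<^sup>2 * onorm ((*v) (?Q ** ?D))" if "\<omega> \<in> space M" for \<omega>
  proof -
    \<comment> \<open>Keeping \<open>?Q ** ?D\<close> as one matrix yields its own operator norm,
      with the same constant \<open>C\<close> as in the bound on \<open>s1\<close>.\<close>
    have "norm ((?Q ** ?D) *v s1 \<omega>) \<le> onorm ((*v) (?Q ** ?D)) * norm (s1 \<omega>)"
      by (intro onorm matrix_vector_mul_bounded_linear)
    also have "\<dots> \<le> onorm ((*v) (?Q ** ?D)) * (C * (Max (range eps))\<^sup>2)"
      using s1_bound[OF that] by (intro mult_left_mono onorm_pos_le matrix_vector_mul_bounded_linear)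
    finally show ?thesis
      by (simp add: mult.commute)
  qed
  moreover have "(\<lambda>\<omega>. - (?Q *v ?z \<omega>)) \<in> borel_measurable M"
    by measurable
  moreover have "(\<lambda>\<omega>. - ((?Q ** ?D) *v s1 \<omega>)) \<in> borel_measurable M"
    using s1_measurable by measurable
  ultimately show ?thesis
    using chi by blast
qed

end
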